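(* Let $A$ be a skew brace and let $I\subset A$ be an ideal of $A$. Let $[I,A]_{\mathsf{RadRng}}$ be the subgroup of $(A,+)$ generated by the elements $[a,b,c]$, $[c,a,b]$, $[b,c,a]$ and $a+b-a-b$ for all $a\in I$ and $b,c\in A$. Then $[I,A]_{\mathsf{RadRng}}$ is an ideal of $A$.
   Context: A skew brace is a triple $(A,+,\circ)$ where $(A,+)$ and $(A,\circ)$ are (not necessarily abelian) groups such that $a\circ(b+c)=a\circ b-a+a\circ c$ for all $a,b,c\in A$. For $a,b\in A$ put $a*b=-a+a\circ b-b$. An ideal of $A$ is a normal subgroup $I$ of $(A,+)$ such that $a*x\in I$ and $x*a\in I$ for all $a\in A$, $x\in I$. The right distributor of $a,b,c\in A$ is $[a,b,c]=(a+b)\circ c-b\circ c+c-a\circ c$. *)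

theory Defs
  imports "HOL-Algebra.Coset" "HOL-Algebra.Ring" "HOL-Algebra.Generated_Groups"
begin

text \<open>
  A skew brace \<open>(A, +, \<circ>)\<close> is carried by a ring record: \<open>\<oplus>\<close> is the (not necessarily
  abelian) operation \<open>+\<close>, and \<open>\<otimes>\<close> is \<open>\<circ>\<close>. Both operations make the whole
  carrier a group; nothing else about rings is assumed.
  As \<open>+\<close> need not commute, the order of the summands below matters:
  \<open>\<oplus>\<close> and \<open>\<ominus>\<close> associate to the left, and \<open>x \<ominus> y\<close> is \<open>x \<oplus> (\<ominus> y)\<close>.
\<close>

locale skew_brace = add: group "add_monoid A" + circ: group A
  for A :: "('a, 'm) ring_scheme" (structure) +
  assumes circ_add_distrib:
    "\<lbrakk> a \<in> carrier A; b \<in> carrier A; c \<in> carrier A \<rbrakk>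
      \<Longrightarrow> a \<otimes> (b \<oplus> c) = a \<otimes> b \<ominus> a \<oplus> a \<otimes> c"

definition brace_star :: "('a, 'm) ring_scheme \<Rightarrow> 'a \<Rightarrow> 'a \<Rightarrow> 'a" where
  "brace_star A a b = \<ominus>\<^bsub>A\<^esub> a \<oplus>\<^bsub>A\<^esub> a \<otimes>\<^bsub>A\<^esub> b \<ominus>\<^bsub>A\<^esub> b"

definition brace_ideal :: "'a set \<Rightarrow> ('a, 'm) ring_scheme \<Rightarrow> bool" where
  "brace_ideal I A \<longleftrightarrow>
     I \<lhd> add_monoid A \<and>
     (\<forall>a \<in> carrier A. \<forall>x \<in> I. brace_star A a x \<in> I \<and> brace_star A x a \<in> I)"

definition right_distributor :: "('a, 'm) ring_scheme \<Rightarrow> 'a \<Rightarrow> 'a \<Rightarrow> 'a \<Rightarrow> 'a" where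
  "right_distributor A a b c =
     (a \<oplus>\<^bsub>A\<^esub> b) \<otimes>\<^bsub>A\<^esub> c \<ominus>\<^bsub>A\<^esub> b \<otimes>\<^bsub>A\<^esub> c \<oplus>\<^bsub>A\<^esub> c \<ominus>\<^bsub>A\<^esub> a \<otimes>\<^bsub>A\<^esub> c"

definition radrng_commutator :: "'a set \<Rightarrow> ('a, 'm) ring_scheme \<Rightarrow> 'a set" where
  "radrng_commutator I A = generate (add_monoid A)
     (\<Union>a \<in> I. \<Union>b \<in> carrier A. \<Union>c \<in> carrier A.
        { right_distributor A a b c, right_distributor A c a b, right_distributor A b c a,
          a \<oplus>\<^bsub>A\<^esub> b \<ominus>\<^bsub>A\<^esub> a \<ominus>\<^bsub>A\<^esub> b })"

end

theory Submission
  imports Defs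
begin

text \<open>
  Write \<open>J\<close> for the subgroup in question and \<open>\<lambda>\<^sub>a(b) = -a + a \<circ> b\<close>. Since \<open>J \<subseteq> I\<close> and \<open>J\<close>
  contains the additive commutators of \<open>I\<close> with \<open>A\<close>, it is normal in \<open>(A, +)\<close> and \<open>I/J\<close> is
  central in \<open>A/J\<close>. Hence, modulo \<open>J\<close>, the vanishing of the distributors says that
  \<open>(a + b) * c = a * c + b * c\<close> as soon as one of \<open>a\<close>, \<open>b\<close>, \<open>c\<close> lies in \<open>I\<close>. Combined with
  \<open>(x \<circ> y) * z = \<lambda>\<^sub>x(y * z) + x * z\<close>, this shows that \<open>\<lambda>\<^sub>d(g)\<close> and \<open>g * d\<close> are trivial modulo
  \<open>J\<close> for every generator \<open>g\<close> of \<open>J\<close>; the elements of \<open>I\<close> with this property form a subgroup.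
\<close>

section \<open>Additive arithmetic, the maps \<open>lam\<close> and the star operation\<close>

context skew_brace
begin

lemmas plus_closed = add.m_closed [simplified]
lemmas plus_assoc = add.m_assoc [simplified]
lemmas plus_zero_closed = add.one_closed [simplified]
lemmas plus_l_zero = add.l_one [simplified]
lemmas plus_r_zero = add.r_one [simplified]
lemmas plus_inv_closed = add.inv_closed [folded a_inv_def, simplified]
lemmas plus_l_neg = add.l_inv [folded a_inv_def, simplified]
lemmas plus_r_neg = add.r_inv [folded a_inv_def, simplified]
lemmas plus_minus_plus = add.inv_mult_group [folded a_inv_def, simplified]
lemmas plus_minus_minus = add.inv_inv [folded a_inv_def, simplified]

lemma neg_plus_cancel:
  assumes "x \<in> carrier A" "y \<in> carrier A"
  shows "\<ominus> x \<oplus> (x \<oplus> y) = y" "x \<oplus> (\<ominus> x \<oplus> y) = y"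
  using assms
  by (simp_all flip: plus_assoc add: plus_inv_closed plus_l_neg plus_r_neg plus_l_zero)

lemma plus_l_cancel:
  assumes "x \<in> carrier A" "y \<in> carrier A" "z \<in> carrier A"
  shows "x \<oplus> y = x \<oplus> z \<longleftrightarrow> y = z"
  using assms neg_plus_cancel(1) by metis

lemmas plus_r_cancel = add.right_cancel [simplified]

text \<open>With these rules a word in \<open>\<oplus>\<close> and \<open>\<ominus>\<close> is
  brought to a reduced, right-associated form, so that identities valid in every group follow by
  simplification.\<close>

lemmas plus_simps = plus_closed plus_assoc plus_zero_closed plus_l_zero plus_r_zero
  plus_inv_closed plus_l_neg plus_r_neg plus_l_cancel plus_minus_plus plus_minus_minus
  neg_plus_cancel a_minus_def

abbreviation star :: "'a \<Rightarrow> 'a \<Rightarrow> 'a"  (infixl "\<star>" 75)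
  where "a \<star> b \<equiv> brace_star A a b"

text \<open>The usual action of the group (A, \<otimes>) on the group (A, \<oplus>);
  \<open>lam_plus\<close>, \<open>lam_circ\<close> and \<open>lam_one\<close> give its laws.\<close>

definition lam :: "'a \<Rightarrow> 'a \<Rightarrow> 'a"
  where "lam a b = \<ominus> a \<oplus> a \<otimes> b"

lemma lam_closed [simp]: "a \<in> carrier A \<Longrightarrow> b \<in> carrier A \<Longrightarrow> lam a b \<in> carrier A"
  by (simp add: lam_def plus_simps)

lemma star_closed [simp]: "a \<in> carrier A \<Longrightarrow> b \<in> carrier A \<Longrightarrow> a \<star> b \<in> carrier A"
  by (simp add: brace_star_def plus_simps)

lemma star_eq_lam: "a \<in> carrier A \<Longrightarrow> b \<in> carrier A \<Longrightarrow> a \<star> b = lam a b \<ominus> b"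
  by (simp add: brace_star_def lam_def)

lemma lam_eq_star: "a \<in> carrier A \<Longrightarrow> b \<in> carrier A \<Longrightarrow> lam a b = a \<star> b \<oplus> b"
  by (simp add: brace_star_def lam_def plus_simps)

lemma circ_eq_lam: "a \<in> carrier A \<Longrightarrow> b \<in> carrier A \<Longrightarrow> a \<otimes> b = a \<oplus> lam a b"
  by (simp add: lam_def plus_simps)

lemma circ_eq_star: "a \<in> carrier A \<Longrightarrow> b \<in> carrier A \<Longrightarrow> a \<otimes> b = a \<oplus> (a \<star> b \<oplus> b)"
  by (simp add: brace_star_def plus_simps)

lemma lam_plus:
  assumes "a \<in> carrier A" "b \<in> carrier A" "c \<in> carrier A"
  shows "lam a (b \<oplus> c) = lam a b \<oplus> lam a c"
  using assms by (simp add: lam_def circ_add_distrib plus_simps)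

lemma lam_hom: "a \<in> carrier A \<Longrightarrow> lam a \<in> hom (add_monoid A) (add_monoid A)"
  by (rule homI) (simp_all add: lam_plus)

text \<open>By associativity of \<open>\<otimes>\<close>, adding \<open>a \<otimes> b\<close> on the
  left turns both sides into \<open>a \<otimes> (b \<otimes> c)\<close>.\<close>

lemma lam_circ:
  assumes "a \<in> carrier A" "b \<in> carrier A" "c \<in> carrier A"
  shows "lam (a \<otimes> b) c = lam a (lam b c)"
proof -
  have "a \<otimes> b \<oplus> lam (a \<otimes> b) c = a \<otimes> (b \<otimes> c)"
    using assms by (simp add: circ_eq_lam [symmetric] circ.m_assoc)
  also have "\<dots> = a \<oplus> lam a (b \<oplus> lam b c)"
    using assms by (simp add: circ_eq_lam plus_simps)
  also have "\<dots> = a \<otimes> b \<oplus> lam a (lam b c)"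
    using assms by (simp add: circ_eq_lam lam_plus plus_simps)
  finally show ?thesis
    using assms by (simp add: plus_l_cancel)
qed

text \<open>Since \<open>lam (a \<otimes> b) c = lam a (b \<star> c \<oplus> c)\<close> and
  \<open>lam a\<close> is additive, subtracting \<open>c\<close> leaves
  \<open>lam a c \<ominus> c\<close>, that is \<open>a \<star> c\<close>, as last summand.\<close>

lemma circ_star:
  assumes "a \<in> carrier A" "b \<in> carrier A" "c \<in> carrier A"
  shows "(a \<otimes> b) \<star> c = lam a (b \<star> c) \<oplus> a \<star> c"
proof -
  have "(a \<otimes> b) \<star> c = lam a (b \<star> c \<oplus> c) \<ominus> c"
    using assms by (simp add: star_eq_lam [of "a \<otimes> b"] lam_circ lam_eq_star [of b])
  also have "\<dots> = lam a (b \<star> c) \<oplus> a \<star> c"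
    using assms by (simp add: lam_plus star_eq_lam [of a c] plus_simps)
  finally show ?thesis .
qed

text \<open>The brace law at \<open>\<one>\<close>, \<open>\<zero>\<close>, \<open>\<zero>\<close>
  collapses to \<open>\<zero> = \<ominus> \<one>\<close>.\<close>

lemma one_eq_zero: "\<one> = \<zero>"
proof -
  have "\<one> \<otimes> (\<zero> \<oplus> \<zero>) = \<one> \<otimes> \<zero> \<ominus> \<one> \<oplus> \<one> \<otimes> \<zero>"
    by (rule circ_add_distrib) (simp_all add: plus_simps)
  then have "\<ominus> \<one> = \<zero>"
    by (simp add: plus_simps)
  then have "\<one> \<oplus> \<ominus> \<one> = \<one>"
    by (simp add: plus_simps)
  then show ?thesis
    by (simp add: plus_simps)
qed

lemma lam_one:
  assumes "a \<in> carrier A"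
  shows "lam \<one> a = a"
proof -
  have "\<ominus> \<one> = \<one>"
    using plus_l_neg [of \<zero>] by (simp add: plus_r_zero plus_inv_closed plus_zero_closed one_eq_zero)
  then have "lam \<one> a = \<one> \<oplus> a"
    using assms by (simp add: lam_def)
  then show ?thesis
    using assms plus_l_zero by (metis one_eq_zero)
qed

lemma zero_star:
  assumes "a \<in> carrier A"
  shows "\<zero> \<star> a = \<zero>"
  using assms lam_one [of a] one_eq_zero by (simp add: star_eq_lam plus_zero_closed plus_r_neg a_minus_def)

lemma right_distributor_closed [simp]:
  assumes "a \<in> carrier A" "b \<in> carrier A" "c \<in> carrier A"
  shows "right_distributor A a b c \<in> carrier A"
  using assms by (simp add: right_distributor_def plus_simps)

text \<open>The definition solved for the product; the distributor becomes a left summand that can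
  be split off under star.\<close>

lemma plus_right_distributor:
  assumes "a \<in> carrier A" "b \<in> carrier A" "c \<in> carrier A"
  shows "(a \<oplus> b) \<otimes> c = right_distributor A a b c \<oplus> (a \<otimes> c \<ominus> c \<oplus> b \<otimes> c)"
  using assms by (simp add: right_distributor_def plus_simps)

text \<open>Adding \<open>c\<close> on the right turns both sides into
  \<open>(a \<oplus> b) \<otimes> c\<close>. In this form the distributor measures the failure of
  star to be additive on the left.\<close>

lemma right_distributor_star:
  assumes "a \<in> carrier A" "b \<in> carrier A" "c \<in> carrier A"
  shows "right_distributor A a b c \<oplus> a \<oplus> a \<star> c \<oplus> b \<oplus> b \<star> c = a \<oplus> b \<oplus> (a \<oplus> b) \<star> c"
proof -
  have "right_distributor A a b c \<oplus> a \<oplus> a \<star> c \<oplus> b \<oplus> b \<star> c \<oplus> c = (a \<oplus> b) \<otimes> c"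
    using assms
    by (simp add: right_distributor_def circ_eq_star [of a] circ_eq_star [of b] plus_simps)
  also have "\<dots> = a \<oplus> b \<oplus> (a \<oplus> b) \<star> c \<oplus> c"
    using assms by (simp add: circ_eq_star plus_simps)
  finally show ?thesis
    using assms by (simp add: plus_r_cancel plus_closed)
qed

end

section \<open>Ideals, and the distributors and commutators they contain\<close>

locale skew_brace_ideal = skew_brace A for A :: "('a, 'm) ring_scheme" (structure) +
  fixes I :: "'a set"
  assumes ideal: "brace_ideal I A"
begin

sublocale I: normal I "add_monoid A"
  using ideal by (simp add: brace_ideal_def)

lemma I_carrier [simp]: "x \<in> I \<Longrightarrow> x \<in> carrier A"
  using I.subset by auto

lemmas I_plus [simp] = I.m_closed [simplified]
lemmas I_neg [simp] = I.m_inv_closed [folded a_inv_def]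
lemmas I_conj = I.inv_op_closed2 [folded a_inv_def, simplified]
lemmas I_conj' = I.inv_op_closed1 [folded a_inv_def, simplified]

lemma I_star [simp]:
  "x \<in> I \<Longrightarrow> a \<in> carrier A \<Longrightarrow> x \<star> a \<in> I"
  "x \<in> I \<Longrightarrow> a \<in> carrier A \<Longrightarrow> a \<star> x \<in> I"
  using ideal by (simp_all add: brace_ideal_def)

lemma I_lam [simp]: "x \<in> I \<Longrightarrow> a \<in> carrier A \<Longrightarrow> lam a x \<in> I"
  by (simp add: lam_eq_star)

text \<open>Right multiplication by \<open>c\<close> respects cosets of \<open>I\<close>: rewrite
  \<open>x \<oplus> i\<close> as a product \<open>x \<otimes> k\<close> with \<open>k\<close> in
  \<open>I\<close>, then use associativity and the additivity of \<open>lam x\<close>.\<close>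

lemma I_coset_circ:
  assumes "x \<in> carrier A" "c \<in> carrier A" "i \<in> I"
  shows "\<exists>j \<in> I. (x \<oplus> i) \<otimes> c = x \<otimes> c \<oplus> j"
proof -
  define k where "k = lam (inv x) i"
  have k: "k \<in> I"
    using assms by (simp add: k_def)
  have "lam x k = lam \<one> i"
    using assms by (simp add: k_def lam_circ [symmetric])
  also have "\<dots> = i"
    using assms by (simp add: lam_one)
  finally have xk: "x \<oplus> i = x \<otimes> k"
    using assms k by (simp add: circ_eq_lam)
  \<comment> \<open>Conjugation by \<open>c\<close> moves \<open>k \<oplus> k \<star> c\<close> to
    the right of \<open>c\<close>.\<close>
  define j where "j = \<ominus> c \<oplus> (k \<oplus> k \<star> c) \<oplus> c"
  have j: "j \<in> I"
    using assms k by (simp add: j_def I_conj')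
  have "k \<otimes> c = c \<oplus> j"
    using assms k by (simp add: j_def circ_eq_star plus_simps)
  then have "(x \<oplus> i) \<otimes> c = x \<otimes> (c \<oplus> j)"
    using assms k by (simp add: xk circ.m_assoc)
  also have "\<dots> = x \<otimes> c \<oplus> lam x j"
    using assms j by (simp add: circ_eq_lam lam_plus plus_simps)
  finally have "(x \<oplus> i) \<otimes> c = x \<otimes> c \<oplus> lam x j" .
  then show ?thesis
    using assms j by auto
qed

text \<open>If \<open>a\<close> or \<open>b\<close> lies in \<open>I\<close>, then
  \<open>(a \<oplus> b) \<otimes> c\<close> is in the coset of \<open>b \<otimes> c\<close> or
  \<open>a \<otimes> c\<close>, and what remains is built from conjugates of elements of
  \<open>I\<close>. If \<open>c\<close> lies in \<open>I\<close>, so do all stars with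
  \<open>c\<close>, and \<open>right_distributor_star\<close> is solved for the distributor.\<close>

lemma right_distributor_I:
  assumes "a \<in> carrier A" "b \<in> carrier A" "c \<in> carrier A" "a \<in> I \<or> b \<in> I \<or> c \<in> I"
  shows "right_distributor A a b c \<in> I"
proof -
  consider "a \<in> I" | "b \<in> I" | "c \<in> I"
    using assms by auto
  then show ?thesis
  proof cases
    case 1
    have conj: "\<ominus> b \<oplus> a \<oplus> b \<in> I"
      using 1 assms by (simp add: I_conj')
    then obtain j where j: "j \<in> I" "(b \<oplus> (\<ominus> b \<oplus> a \<oplus> b)) \<otimes> c = b \<otimes> c \<oplus> j"
      using I_coset_circ [OF assms(2,3) conj] by blast
    then have "(a \<oplus> b) \<otimes> c = b \<otimes> c \<oplus> j"
      using assms by (simp add: plus_simps)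
    then have "right_distributor A a b c
        = b \<otimes> c \<oplus> j \<oplus> \<ominus> (b \<otimes> c) \<oplus> \<ominus> (a \<oplus> a \<star> c)"
      using assms j by (simp add: right_distributor_def circ_eq_star [of a] plus_simps)
    moreover have "b \<otimes> c \<oplus> j \<oplus> \<ominus> (b \<otimes> c) \<in> I" "\<ominus> (a \<oplus> a \<star> c) \<in> I"
      using 1 assms j I_conj by simp_all
    ultimately show ?thesis
      by (metis I_plus)
  next
    case 2
    then obtain j where j: "j \<in> I" "(a \<oplus> b) \<otimes> c = a \<otimes> c \<oplus> j"
      using I_coset_circ [OF assms(1,3)] by blast
    define k where "k = \<ominus> c \<oplus> \<ominus> (b \<oplus> b \<star> c) \<oplus> c"
    have k: "k \<in> I"
      using 2 assms by (simp add: k_def I_conj')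
    have "right_distributor A a b c = a \<otimes> c \<oplus> (j \<oplus> k) \<oplus> \<ominus> (a \<otimes> c)"
      using assms j by (simp add: right_distributor_def k_def circ_eq_star [of b] plus_simps)
    then show ?thesis
      using assms j k by (simp add: I_conj)
  next
    case 3
    define k where "k = (a \<oplus> b) \<star> c \<oplus> \<ominus> (b \<star> c)"
    define l where "l = b \<oplus> k \<oplus> \<ominus> b"
    have l: "l \<in> I"
      using 3 assms by (simp add: k_def l_def I_conj plus_closed)
    have "right_distributor A a b c \<oplus> (a \<oplus> a \<star> c \<oplus> b \<oplus> b \<star> c) = a \<oplus> b \<oplus> (a \<oplus> b) \<star> c"
      using assms right_distributor_star [of a b c] by (simp add: plus_assoc plus_closed)
    also have "\<dots> = a \<oplus> (l \<oplus> \<ominus> (a \<star> c)) \<oplus> \<ominus> a \<oplus> (a \<oplus> a \<star> c \<oplus> b \<oplus> b \<star> c)"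
      using assms by (simp add: k_def l_def plus_simps)
    finally have "right_distributor A a b c = a \<oplus> (l \<oplus> \<ominus> (a \<star> c)) \<oplus> \<ominus> a"
      using assms l by (simp add: plus_r_cancel plus_closed plus_inv_closed)
    then show ?thesis
      using 3 assms l by (simp add: I_conj)
  qed
qed

lemma commutator_I:
  assumes "a \<in> I" "b \<in> carrier A"
  shows "a \<oplus> b \<ominus> a \<ominus> b \<in> I"
proof -
  have "a \<oplus> b \<ominus> a \<ominus> b = a \<oplus> (b \<oplus> \<ominus> a \<oplus> \<ominus> b)"
    using assms by (simp add: plus_simps)
  then show ?thesis
    using assms by (simp add: I_conj)
qed

section \<open>The subgroup \<open>J\<close>: generators, minimality, normality\<close>

abbreviation J where "J \<equiv> radrng_commutator I A"

text \<open>The three cyclic forms of the generators place the element of \<open>I\<close> in the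
  first, second and third position.\<close>

lemma right_distributor_J:
  assumes "a \<in> carrier A" "b \<in> carrier A" "c \<in> carrier A" "a \<in> I \<or> b \<in> I \<or> c \<in> I"
  shows "right_distributor A a b c \<in> J"
  unfolding radrng_commutator_def using assms by (intro generate.incl) blast

lemma commutator_J:
  assumes "a \<in> I" "b \<in> carrier A"
  shows "a \<oplus> b \<ominus> a \<ominus> b \<in> J"
  unfolding radrng_commutator_def using assms by (intro generate.incl) blast

text \<open>The induction principle for \<open>J\<close>, used for \<open>T = I\<close> and for the
  subgroup of stable elements.\<close>

lemma J_minimal:
  assumes "subgroup T (add_monoid A)"
    and "\<And>a b c. \<lbrakk> a \<in> carrier A; b \<in> carrier A; c \<in> carrier A; a \<in> I \<or> b \<in> I \<or> c \<in> I \<rbrakk>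
      \<Longrightarrow> right_distributor A a b c \<in> T"
    and "\<And>a b. \<lbrakk> a \<in> I; b \<in> carrier A \<rbrakk> \<Longrightarrow> a \<oplus> b \<ominus> a \<ominus> b \<in> T"
  shows "J \<subseteq> T"
  unfolding radrng_commutator_def
  using assms(1) by (intro add.generate_subgroup_incl UN_least) (simp_all add: assms(2,3))

lemma J_subset_I: "J \<subseteq> I"
  by (rule J_minimal) (simp_all add: I.subgroup_axioms right_distributor_I commutator_I)

lemma subgroup_J: "subgroup J (add_monoid A)"
  unfolding radrng_commutator_def
  by (intro add.generate_is_subgroup UN_least)
    (simp add: plus_closed plus_inv_closed a_minus_def)

text \<open>A conjugate \<open>g \<oplus> x \<oplus> \<ominus> g\<close> differs from
  \<open>x\<close> by the negative of the commutator of \<open>x\<close> and \<open>g\<close>, which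
  is a generator because \<open>x\<close> lies in \<open>I\<close>.\<close>

lemma normal_J: "J \<lhd> add_monoid A"
proof -
  interpret J: subgroup J "add_monoid A"
    by (rule subgroup_J)
  have "g \<oplus> x \<oplus> \<ominus> g \<in> J" if "g \<in> carrier A" "x \<in> J" for g x
  proof -
    have x: "x \<in> I"
      using that J_subset_I by auto
    have "\<ominus> (x \<oplus> g \<ominus> x \<ominus> g) \<oplus> x \<in> J"
      using that x commutator_J J.m_closed J.m_inv_closed [folded a_inv_def] by simp
    moreover have "\<ominus> (x \<oplus> g \<ominus> x \<ominus> g) \<oplus> x = g \<oplus> x \<oplus> \<ominus> g"
      using that x by (simp add: plus_simps)
    ultimately show ?thesis
      by simp
  qed
  then show ?thesis
    using subgroup_J by (simp add: add.normal_inv_iff a_inv_def)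
qed

lemma J_coset: "x \<in> J \<Longrightarrow> J #>\<^bsub>add_monoid A\<^esub> x = J"
  using subgroup_J add.coset_join2 J_subset_I by auto

lemma coset_eq_J: "x \<in> carrier A \<Longrightarrow> J #>\<^bsub>add_monoid A\<^esub> x = J \<Longrightarrow> x \<in> J"
  using subgroup_J by (simp add: add.coset_join1 subgroup.subset)

end

section \<open>Star and \<open>lam\<close> modulo vanishing distributors\<close>

text \<open>
  The map \<open>p\<close> stands for the projection \<open>A \<rightarrow> A/J\<close>.
\<close>

locale distributive_quotient = skew_brace_ideal A I + H: group H
  for A :: "('a, 'm) ring_scheme" (structure) and I :: "'a set" and H :: "('c, 'd) monoid_scheme" +
  fixes p
  assumes p_hom: "p \<in> hom (add_monoid A) H"
    and p_central: "\<lbrakk> x \<in> I; a \<in> carrier A \<rbrakk> \<Longrightarrow> p x \<otimes>\<^bsub>H\<^esub> p a = p a \<otimes>\<^bsub>H\<^esub> p x"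
    and p_distributor: "\<lbrakk> a \<in> carrier A; b \<in> carrier A; c \<in> carrier A; a \<in> I \<or> b \<in> I \<or> c \<in> I \<rbrakk>
      \<Longrightarrow> p (right_distributor A a b c) = \<one>\<^bsub>H\<^esub>"
begin

sublocale p: group_hom "add_monoid A" H p
  by unfold_locales (rule p_hom)

abbreviation hmult (infixl "\<bullet>" 70) where "x \<bullet> y \<equiv> x \<otimes>\<^bsub>H\<^esub> y"

lemmas p_closed [simp] = p.hom_closed [simplified]
lemmas p_plus = p.hom_mult [simplified]
lemmas p_zero = p.hom_one [simplified]

lemma p_lcomm:
  assumes "x \<in> I" "a \<in> carrier A" "y \<in> carrier H"
  shows "p a \<bullet> (p x \<bullet> y) = p x \<bullet> (p a \<bullet> y)"
  using assms by (simp flip: H.m_assoc add: p_central)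

text \<open>Apply \<open>p\<close> to \<open>right_distributor_star\<close>: the distributor
  vanishes and \<open>p a\<close> cancels. The images of \<open>a \<star> c\<close> and
  \<open>b\<close> commute, since one of these two elements lies in \<open>I\<close>.\<close>

lemma p_star_plus:
  assumes "a \<in> carrier A" "b \<in> carrier A" "c \<in> carrier A" "a \<in> I \<or> b \<in> I \<or> c \<in> I"
  shows "p ((a \<oplus> b) \<star> c) = p (a \<star> c) \<bullet> p (b \<star> c)"
proof -
  have "p a \<bullet> (p (a \<star> c) \<bullet> (p b \<bullet> p (b \<star> c))) = p a \<bullet> (p b \<bullet> p ((a \<oplus> b) \<star> c))"
    using right_distributor_star [of a b c, THEN arg_cong [of _ _ p]] assms
    by (simp add: p_plus p_distributor plus_closed H.m_assoc)
  moreover have "a \<star> c \<in> I \<or> b \<in> I"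
    using assms by auto
  then have "p (a \<star> c) \<bullet> (p b \<bullet> p (b \<star> c)) = p b \<bullet> (p (a \<star> c) \<bullet> p (b \<star> c))"
    using assms p_lcomm [of "a \<star> c" b "p (b \<star> c)"] p_lcomm [of b "a \<star> c" "p (b \<star> c)"]
    by (elim disjE) simp_all
  ultimately show ?thesis
    using assms by (simp add: plus_closed)
qed

text \<open>Expand \<open>(x \<otimes> y) \<star> z\<close> twice: additively, from
  \<open>x \<otimes> y = x \<oplus> (x \<star> y \<oplus> y)\<close>, and by
  \<open>circ_star\<close>. Centrality lets the common factors cancel.\<close>

lemma p_star_assoc:
  assumes "x \<in> carrier A" "y \<in> I" "z \<in> carrier A"
  shows "p ((x \<star> y) \<star> z) = p (x \<star> (y \<star> z))"
proof -
  have "p (x \<star> z) \<bullet> p ((x \<star> y) \<star> z) \<bullet> p (y \<star> z) = p ((x \<otimes> y) \<star> z)"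
    using assms by (simp add: circ_eq_star p_star_plus plus_closed H.m_assoc)
  also have "\<dots> = p (x \<star> (y \<star> z)) \<bullet> p (y \<star> z) \<bullet> p (x \<star> z)"
    using assms by (simp add: circ_star lam_eq_star p_plus plus_closed)
  also have "\<dots> = p (x \<star> z) \<bullet> p (x \<star> (y \<star> z)) \<bullet> p (y \<star> z)"
    using assms by (simp add: H.m_assoc p_central [of "y \<star> z" "x \<star> z"] p_lcomm [of "x \<star> (y \<star> z)" "x \<star> z"])
  finally show ?thesis
    using assms by (simp add: H.m_assoc)
qed

lemma p_lam_star_plus:
  assumes "a \<in> carrier A" "b \<in> carrier A" "c \<in> carrier A" "a \<in> I \<or> b \<in> I \<or> c \<in> I"
    and d: "d \<in> carrier A"
  shows "p (lam d ((a \<oplus> b) \<star> c)) = p (lam d (a \<star> c)) \<bullet> p (lam d (b \<star> c))"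
proof -
  have eq: "p (lam d ((a \<oplus> b) \<star> c)) \<bullet> p (d \<star> c) = p ((d \<otimes> (a \<oplus> b)) \<star> c)"
    using assms by (simp add: circ_star p_plus plus_closed)
  have "p ((d \<otimes> (a \<oplus> b)) \<star> c) = p (lam d (a \<star> c)) \<bullet> p (lam d (b \<star> c)) \<bullet> p (d \<star> c)"
  proof (cases "b \<in> I")
    case True
    \<comment> \<open>Two expansions of \<open>(d \<otimes> b) \<star> c\<close> give the rule that
      moves \<open>p (d \<star> c)\<close> to the end.\<close>
    have "p (d \<star> c) \<bullet> p (lam d b \<star> c) = p ((d \<otimes> b) \<star> c)"
      using assms True by (simp add: circ_eq_lam p_star_plus)
    also have "\<dots> = p (lam d (b \<star> c)) \<bullet> p (d \<star> c)"
      using assms by (simp add: circ_star p_plus)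
    finally have *: "p (d \<star> c) \<bullet> p (lam d b \<star> c) = p (lam d (b \<star> c)) \<bullet> p (d \<star> c)" .
    have "d \<otimes> (a \<oplus> b) = d \<otimes> a \<oplus> lam d b"
      using assms by (simp add: circ_eq_lam lam_plus plus_simps)
    then have "p ((d \<otimes> (a \<oplus> b)) \<star> c) = p ((d \<otimes> a) \<star> c) \<bullet> p (lam d b \<star> c)"
      using assms True by (simp add: p_star_plus)
    then show ?thesis
      using assms * by (simp add: circ_star p_plus H.m_assoc)
  next
    case False
    \<comment> \<open>Chosen so that \<open>i \<oplus> d = d \<otimes> a\<close>, which gives
      \<open>d \<otimes> (a \<oplus> b) = i \<oplus> d \<otimes> b\<close>; it lies in
      \<open>I\<close> when \<open>a\<close> does.\<close>
    define i where "i = d \<oplus> lam d a \<oplus> \<ominus> d"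
    have i: "i \<in> carrier A" "i \<in> I \<or> c \<in> I"
      using assms False I_conj by (auto simp: i_def plus_simps)
    have "p (i \<star> c) \<bullet> p (d \<star> c) = p ((d \<otimes> a) \<star> c)"
      using assms i p_star_plus [of i d c] by (auto simp: i_def circ_eq_lam plus_simps)
    also have "\<dots> = p (lam d (a \<star> c)) \<bullet> p (d \<star> c)"
      using assms by (simp add: circ_star p_plus)
    finally have *: "p (i \<star> c) = p (lam d (a \<star> c))"
      using assms i by simp
    have "d \<otimes> (a \<oplus> b) = i \<oplus> d \<otimes> b"
      using assms by (simp add: i_def circ_eq_lam lam_plus plus_simps)
    then have "p ((d \<otimes> (a \<oplus> b)) \<star> c) = p (i \<star> c) \<bullet> p ((d \<otimes> b) \<star> c)"
      using assms i by (auto simp add: p_star_plus)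
    then show ?thesis
      using assms * by (simp add: circ_star p_plus H.m_assoc)
  qed
  with eq show ?thesis
    using assms by (simp add: plus_closed)
qed

text \<open>Apply \<open>lam d\<close> and then \<open>p\<close> to
  \<open>right_distributor_star\<close>. By \<open>p_lam_star_plus\<close> and centrality,
  everything but the distributor cancels.\<close>

lemma p_lam_distributor:
  assumes "a \<in> carrier A" "b \<in> carrier A" "c \<in> carrier A" "a \<in> I \<or> b \<in> I \<or> c \<in> I"
    and "d \<in> carrier A"
  shows "p (lam d (right_distributor A a b c)) = \<one>\<^bsub>H\<^esub>"
proof -
  let ?r = "p (lam d (right_distributor A a b c))"
  let ?w = "p (lam d (a \<star> c)) \<bullet> (p (lam d b) \<bullet> p (lam d (b \<star> c)))"
  have "p (lam d (right_distributor A a b c \<oplus> a \<oplus> a \<star> c \<oplus> b \<oplus> b \<star> c))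
      = p (lam d (a \<oplus> b \<oplus> (a \<oplus> b) \<star> c))"
    using assms by (simp add: right_distributor_star)
  then have "?r \<bullet> (p (lam d a) \<bullet> ?w)
      = p (lam d a) \<bullet> (p (lam d b) \<bullet> (p (lam d (a \<star> c)) \<bullet> p (lam d (b \<star> c))))"
    using assms by (simp add: lam_plus p_plus plus_closed H.m_assoc p_lam_star_plus)
  moreover have "lam d (a \<star> c) \<in> I \<or> lam d b \<in> I"
    using assms by auto
  then have "p (lam d b) \<bullet> (p (lam d (a \<star> c)) \<bullet> p (lam d (b \<star> c))) = ?w"
    using assms p_lcomm [of "lam d (a \<star> c)" "lam d b" "p (lam d (b \<star> c))"]
      p_lcomm [of "lam d b" "lam d (a \<star> c)" "p (lam d (b \<star> c))"]
    by (elim disjE) simp_all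
  ultimately show ?thesis
    using assms by simp
qed

text \<open>Expand \<open>((a \<oplus> b) \<otimes> c) \<star> d\<close> by
  \<open>circ_star\<close>, and also by splitting off the distributor, which lies in
  \<open>I\<close>. It remains to see that the other summand alone already accounts for the whole
  value \<open>?s\<close>.\<close>

lemma p_distributor_star:
  assumes "a \<in> carrier A" "b \<in> carrier A" "c \<in> carrier A" "a \<in> I \<or> b \<in> I \<or> c \<in> I"
    and "d \<in> carrier A" and r: "right_distributor A a b c \<in> I"
  shows "p (right_distributor A a b c \<star> d) = \<one>\<^bsub>H\<^esub>"
proof -
  let ?r = "right_distributor A a b c"
  let ?s = "p (a \<star> (c \<star> d)) \<bullet> (p (b \<star> (c \<star> d)) \<bullet> (p (c \<star> d) \<bullet> p ((a \<oplus> b) \<star> d)))"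
  have "p (?r \<star> d) \<bullet> p ((a \<otimes> c \<ominus> c \<oplus> b \<otimes> c) \<star> d) = p (((a \<oplus> b) \<otimes> c) \<star> d)"
    using assms by (simp add: plus_right_distributor p_star_plus plus_closed plus_inv_closed a_minus_def)
  also have "\<dots> = ?s"
    using assms p_star_plus [of a b "c \<star> d"]
    by (auto simp: circ_star lam_eq_star p_plus plus_closed H.m_assoc)
  finally have "p (?r \<star> d) \<bullet> p ((a \<otimes> c \<ominus> c \<oplus> b \<otimes> c) \<star> d) = ?s" .
  moreover have "p ((a \<otimes> c \<ominus> c \<oplus> b \<otimes> c) \<star> d) = ?s"
  proof -
    consider "a \<in> I" | "b \<in> I" | "c \<in> I"
      using assms by auto
    then show ?thesis
    proof cases
      case 1
      \<comment> \<open>This is \<open>a \<otimes> c \<ominus> c\<close>; expanding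
        \<open>(a \<otimes> c) \<star> d\<close> in two ways determines
        \<open>p (i \<star> d)\<close>.\<close>
      define i where "i = a \<oplus> a \<star> c"
      have i: "i \<in> I"
        using 1 assms by (simp add: i_def)
      have "p (i \<star> d) \<bullet> p (c \<star> d) = p ((a \<otimes> c) \<star> d)"
        using 1 assms i by (simp add: i_def circ_eq_star plus_simps flip: p_star_plus)
      also have "\<dots> = p (a \<star> (c \<star> d)) \<bullet> (p (c \<star> d) \<bullet> p (a \<star> d))"
        using assms by (simp add: circ_star lam_eq_star p_plus plus_closed H.m_assoc)
      also have "\<dots> = p (a \<star> (c \<star> d)) \<bullet> p (a \<star> d) \<bullet> p (c \<star> d)"
        using 1 assms by (simp add: p_central [of "a \<star> d" "c \<star> d"] H.m_assoc)
      finally have *: "p (i \<star> d) = p (a \<star> (c \<star> d)) \<bullet> p (a \<star> d)"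
        using 1 assms i by simp
      have "a \<otimes> c \<ominus> c \<oplus> b \<otimes> c = i \<oplus> b \<otimes> c"
        using assms by (simp add: i_def circ_eq_star plus_simps)
      then have "p ((a \<otimes> c \<ominus> c \<oplus> b \<otimes> c) \<star> d) = p (i \<star> d) \<bullet> p ((b \<otimes> c) \<star> d)"
        using assms i by (simp add: p_star_plus)
      then show ?thesis
        using 1 assms * by (simp add: circ_star lam_eq_star p_plus plus_closed p_star_plus p_lcomm H.m_assoc)
    next
      case 2
      \<comment> \<open>This is \<open>\<ominus> c \<oplus> b \<otimes> c\<close>, the mirror image
        of the previous case.\<close>
      define k where "k = \<ominus> c \<oplus> (b \<oplus> b \<star> c) \<oplus> c"
      have k: "k \<in> I"
        using 2 assms by (simp add: k_def I_conj')
      have "p (c \<star> d) \<bullet> p (k \<star> d) = p ((b \<otimes> c) \<star> d)"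
        using 2 assms k by (simp add: k_def circ_eq_star plus_simps flip: p_star_plus)
      also have "\<dots> = p (b \<star> (c \<star> d)) \<bullet> (p (c \<star> d) \<bullet> p (b \<star> d))"
        using assms by (simp add: circ_star lam_eq_star p_plus plus_closed H.m_assoc)
      also have "\<dots> = p (c \<star> d) \<bullet> (p (b \<star> (c \<star> d)) \<bullet> p (b \<star> d))"
        using 2 assms by (simp add: p_lcomm [of "b \<star> (c \<star> d)" "c \<star> d"])
      finally have *: "p (k \<star> d) = p (b \<star> (c \<star> d)) \<bullet> p (b \<star> d)"
        using 2 assms k by simp
      have "a \<otimes> c \<ominus> c \<oplus> b \<otimes> c = a \<otimes> c \<oplus> k"
        using assms by (simp add: k_def circ_eq_star plus_simps)
      then have "p ((a \<otimes> c \<ominus> c \<oplus> b \<otimes> c) \<star> d) = p ((a \<otimes> c) \<star> d) \<bullet> p (k \<star> d)"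
        using assms k by (simp add: p_star_plus)
      then show ?thesis
        using 2 assms *
        by (simp add: circ_star lam_eq_star p_plus plus_closed p_star_plus H.m_assoc
            p_lcomm [of "b \<star> (c \<star> d)" "c \<star> d"] p_lcomm [of "b \<star> (c \<star> d)" "a \<star> d"])
    next
      case 3
      \<comment> \<open>Here \<open>a \<star> c\<close> is moved past \<open>b\<close>, to bring
        \<open>a \<oplus> b\<close> together in front. Its star with \<open>d\<close> is evaluated
        by \<open>p_star_assoc\<close>, as \<open>c\<close> lies in \<open>I\<close>.\<close>
      define j where "j = \<ominus> b \<oplus> a \<star> c \<oplus> b"
      have j: "j \<in> I"
        using 3 assms by (simp add: j_def I_conj')
      have "p (b \<star> d) \<bullet> p (j \<star> d) = p ((a \<star> c \<oplus> b) \<star> d)"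
        using 3 assms j by (simp add: j_def plus_simps flip: p_star_plus)
      also have "\<dots> = p (b \<star> d) \<bullet> p (a \<star> (c \<star> d))"
        using 3 assms by (simp add: p_star_plus p_star_assoc p_central)
      finally have *: "p (j \<star> d) = p (a \<star> (c \<star> d))"
        using 3 assms j by simp
      have "a \<otimes> c \<ominus> c \<oplus> b \<otimes> c = a \<oplus> b \<oplus> (j \<oplus> (b \<star> c \<oplus> c))"
        using assms by (simp add: j_def circ_eq_star plus_simps)
      then have "p ((a \<otimes> c \<ominus> c \<oplus> b \<otimes> c) \<star> d)
          = p ((a \<oplus> b) \<star> d) \<bullet> (p (j \<star> d) \<bullet> (p ((b \<star> c) \<star> d) \<bullet> p (c \<star> d)))"
        using 3 assms j by (simp add: p_star_plus plus_closed)
      then show ?thesis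
        using 3 assms * by (simp add: p_star_assoc p_lcomm plus_closed p_central [of _ "(a \<oplus> b)\<star>d"])
    qed
  qed
  ultimately show ?thesis
    using assms by (simp add: plus_closed)
qed

text \<open>The commutator \<open>k\<close> satisfies
  \<open>k \<oplus> (b \<oplus> a) = a \<oplus> b\<close>. Both maps turn these sums into products,
  in which the images coming from \<open>a\<close> and \<open>b\<close> commute because
  \<open>a\<close> lies in \<open>I\<close>.\<close>

lemma p_commutator:
  assumes "a \<in> I" "b \<in> carrier A" "d \<in> carrier A"
  shows "p (lam d (a \<oplus> b \<ominus> a \<ominus> b)) = \<one>\<^bsub>H\<^esub>"
    and "p ((a \<oplus> b \<ominus> a \<ominus> b) \<star> d) = \<one>\<^bsub>H\<^esub>"
proof -
  define k where "k = a \<oplus> b \<ominus> a \<ominus> b"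
  have k: "k \<in> I"
    using assms by (simp add: k_def commutator_I)
  have eq: "k \<oplus> (b \<oplus> a) = a \<oplus> b"
    using assms by (simp add: k_def plus_simps)
  have "p (lam d k) \<bullet> (p (lam d b) \<bullet> p (lam d a)) = p (lam d b) \<bullet> p (lam d a)"
    using eq [THEN arg_cong [of _ _ "\<lambda>x. p (lam d x)"]] assms k
    by (simp add: lam_plus p_plus plus_closed p_central [of "lam d a" "lam d b"])
  then show "p (lam d (a \<oplus> b \<ominus> a \<ominus> b)) = \<one>\<^bsub>H\<^esub>"
    using assms k by (simp flip: k_def)
  have "p (k \<star> d) \<bullet> (p (b \<star> d) \<bullet> p (a \<star> d)) = p (b \<star> d) \<bullet> p (a \<star> d)"
    using eq [THEN arg_cong [of _ _ "\<lambda>x. p (x \<star> d)"]] assms k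
    by (simp add: p_star_plus plus_closed p_central [of "a \<star> d" "b \<star> d"])
  then show "p ((a \<oplus> b \<ominus> a \<ominus> b) \<star> d) = \<one>\<^bsub>H\<^esub>"
    using assms k by (simp flip: k_def)
qed

section \<open>Stable elements form a subgroup containing \<open>J\<close>\<close>

text \<open>For each \<open>d\<close>, both conditions define kernels of homomorphisms from
  \<open>I\<close>, by \<open>lam_plus\<close> and \<open>p_star_plus\<close>.\<close>

lemma subgroup_stable:
  "subgroup {x \<in> I. \<forall>d \<in> carrier A. p (lam d x) = \<one>\<^bsub>H\<^esub> \<and> p (x \<star> d) = \<one>\<^bsub>H\<^esub>} (add_monoid A)"
  (is "subgroup ?T _")
proof (rule add.subgroupI)
  show "?T \<subseteq> carrier (add_monoid A)"
    by auto
  have lam_zero: "lam d \<zero> = \<zero>" if "d \<in> carrier A" for d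
    using that hom_one [OF lam_hom] add.is_group by fastforce
  have "\<zero> \<in> I"
    using I.one_closed by simp
  then show "?T \<noteq> {}"
    using lam_zero zero_star p_zero by auto
  fix x assume x: "x \<in> ?T"
  have "p (lam d (\<ominus> x)) = \<one>\<^bsub>H\<^esub>" if "d \<in> carrier A" for d
  proof -
    have "p (lam d (\<ominus> x)) = p (lam d (\<ominus> x) \<oplus> lam d x)"
      using that x by (simp add: p_plus)
    also have "\<dots> = \<one>\<^bsub>H\<^esub>"
      using that x by (simp add: lam_plus [symmetric] plus_l_neg lam_zero p_zero)
    finally show ?thesis .
  qed
  moreover have "p ((\<ominus> x) \<star> d) = \<one>\<^bsub>H\<^esub>" if "d \<in> carrier A" for d
    using p_star_plus [of "\<ominus> x" x d] that x
    by (simp add: plus_l_neg zero_star p_zero plus_inv_closed)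
  ultimately show "inv\<^bsub>add_monoid A\<^esub> x \<in> ?T"
    using x by (simp flip: a_inv_def)
next
  fix x y assume "x \<in> ?T" "y \<in> ?T"
  then show "x \<otimes>\<^bsub>add_monoid A\<^esub> y \<in> ?T"
    by (auto simp: lam_plus p_plus p_star_plus)
qed

lemma J_stable:
  "J \<subseteq> {x \<in> I. \<forall>d \<in> carrier A. p (lam d x) = \<one>\<^bsub>H\<^esub> \<and> p (x \<star> d) = \<one>\<^bsub>H\<^esub>}"
proof (rule J_minimal [OF subgroup_stable], goal_cases)
  case (1 a b c)
  then show ?case
    by (simp add: right_distributor_I p_lam_distributor p_distributor_star)
next
  case (2 a b)
  then show ?case
    by (simp add: commutator_I p_commutator)
qed

lemma p_lam_J: "x \<in> J \<Longrightarrow> d \<in> carrier A \<Longrightarrow> p (lam d x) = \<one>\<^bsub>H\<^esub>"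
  and p_J_star: "x \<in> J \<Longrightarrow> d \<in> carrier A \<Longrightarrow> p (x \<star> d) = \<one>\<^bsub>H\<^esub>"
  using J_stable by blast+

end

section \<open>Passage to the quotient by \<open>J\<close>\<close>

context skew_brace_ideal
begin

text \<open>Centrality holds since \<open>x \<oplus> a\<close> is a commutator from \<open>J\<close>
  plus \<open>a \<oplus> x\<close>; distributors vanish because they lie in
  \<open>J\<close>.\<close>

lemma quotient_J:
  "distributive_quotient A I (add_monoid A Mod J) (\<lambda>x. J #>\<^bsub>add_monoid A\<^esub> x)"
proof -
  interpret J: normal J "add_monoid A"
    by (rule normal_J)
  interpret H: group "add_monoid A Mod J"
    by (rule J.factorgroup_is_group)
  let ?p = "\<lambda>x. J #>\<^bsub>add_monoid A\<^esub> x"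
  have hom: "?p \<in> hom (add_monoid A) (add_monoid A Mod J)"
    by (rule J.r_coset_hom_Mod)
  show ?thesis
  proof unfold_locales
    show "?p \<in> hom (add_monoid A) (add_monoid A Mod J)"
      by (rule hom)
  next
    fix x a assume xa: "x \<in> I" "a \<in> carrier A"
    have p_plus: "?p (u \<oplus> v) = ?p u \<otimes>\<^bsub>add_monoid A Mod J\<^esub> ?p v"
      if "u \<in> carrier A" "v \<in> carrier A" for u v
      using hom_mult [OF hom, of u v] that by simp
    have closed: "?p u \<in> carrier (add_monoid A Mod J)" if "u \<in> carrier A" for u
      using hom_in_carrier [OF hom, of u] that by simp
    have "?p x \<otimes>\<^bsub>add_monoid A Mod J\<^esub> ?p a = ?p ((x \<oplus> a \<ominus> x \<ominus> a) \<oplus> (a \<oplus> x))"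
      using xa by (simp add: p_plus [symmetric] plus_simps del: mult_FactGroup)
    also have "\<dots> = ?p (x \<oplus> a \<ominus> x \<ominus> a) \<otimes>\<^bsub>add_monoid A Mod J\<^esub> ?p (a \<oplus> x)"
      using xa by (intro p_plus) (simp_all add: plus_simps)
    also have "\<dots> = ?p (a \<oplus> x)"
      using H.l_one [OF closed, of "a \<oplus> x"] xa
      by (simp add: J_coset commutator_J plus_closed)
    also have "\<dots> = ?p a \<otimes>\<^bsub>add_monoid A Mod J\<^esub> ?p x"
      using xa by (intro p_plus) simp_all
    finally show "?p x \<otimes>\<^bsub>add_monoid A Mod J\<^esub> ?p a = ?p a \<otimes>\<^bsub>add_monoid A Mod J\<^esub> ?p x" .
  qed (simp add: J_coset right_distributor_J)
qed

text \<open>The kernel of the projection is \<open>J\<close>, so stability puts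
  \<open>lam d x\<close> and \<open>x \<star> d\<close> in \<open>J\<close>; then
  \<open>d \<star> x = lam d x \<oplus> \<ominus> x\<close> handles the other side.\<close>

lemma brace_ideal_J: "brace_ideal J A"
proof -
  interpret J: subgroup J "add_monoid A"
    by (rule subgroup_J)
  have J_carrier: "x \<in> carrier A" if "x \<in> J" for x
    using that J.subset by auto
  have *: "lam d x \<in> J" "x \<star> d \<in> J" if "x \<in> J" "d \<in> carrier A" for x d
    using distributive_quotient.p_lam_J [OF quotient_J that]
      distributive_quotient.p_J_star [OF quotient_J that] that J_carrier
    by (simp_all add: coset_eq_J)
  moreover have "d \<star> x \<in> J" if "x \<in> J" "d \<in> carrier A" for x d
  proof -
    have "d \<star> x = lam d x \<oplus> \<ominus> x"
      using that J_carrier by (simp add: star_eq_lam a_minus_def)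
    then show ?thesis
      using that * J.m_closed J.m_inv_closed [folded a_inv_def] by simp
  qed
  ultimately show ?thesis
    using normal_J by (simp add: brace_ideal_def)
qed

end

theorem proposition4p8:
  fixes A :: "('a, 'm) ring_scheme" and I :: "'a set"
  assumes "skew_brace A"
    and "brace_ideal I A"
  shows "brace_ideal (radrng_commutator I A) A"
proof -
  interpret skew_brace_ideal A I
    using assms by (simp add: skew_brace_ideal_def skew_brace_ideal_axioms_def)
  show ?thesis
    by (rule brace_ideal_J)
qed

end
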